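(* (1) Let $\{a_k\}_{k=1}^\infty$ be a sequence of positive real numbers satisfying $$a_{2j-1}\ \ge\ \frac{2j}{2j-1}\,a_{2j}\qquad\text{and}\qquad a_{2j}\ \ge\ \frac{2j+1}{2j+2}\,a_{2j+1}\qquad (j=1,2,3,\dots).$$ Then $\sum a_k\sin(kx)$ is a PS in $[0,\pi]$, i.e. $\sum_{k=1}^n a_k\sin(kx)\ge 0$ for all $x\in[0,\pi]$ and all integers $n\ge 1$. (2) The maximal sum is $\sum\gamma_k\sin(kx)$, where $\gamma_k=\frac{k+1}{k}$ for odd $k$ and $\gamma_k=1$ for even $k$; that is, $\{\gamma_k\}$ satisfies the conditions in (1), and $\{\gamma_k\}\succeq\{a_k\}$ for every sequence $\{a_k\}$ of positive real numbers satisfying the conditions in (1).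
   Context: A sum is called a PS (P-Sum) on an interval if all its partial sums are nonnegative on that interval. For sequences of positive real numbers, $\{a_k\}\succeq\{b_k\}$ means that the sequence $b_k/a_k$ is non-increasing in $k$; sequences differing by a non-zero multiple are regarded as equivalent. A sequence is called maximal for a set of conditions if it satisfies the conditions and is $\succeq$ every sequence satisfying them. *)

theory Defs
  imports Complex_Main
begin

text \<open>Sequences and series are indexed by \<open>k \<ge> 1\<close>; values at index 0 are irrelevant
  throughout.\<close>

definition PS_on :: "(nat \<Rightarrow> real \<Rightarrow> real) \<Rightarrow> real set \<Rightarrow> bool" where
  "PS_on f S \<longleftrightarrow> (\<forall>n\<ge>1. \<forall>x\<in>S. 0 \<le> (\<Sum>k=1..n. f k x))"

definition pos_seq :: "(nat \<Rightarrow> real) \<Rightarrow> bool" where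
  "pos_seq a \<longleftrightarrow> (\<forall>k\<ge>1. 0 < a k)"

definition seq_succeq :: "(nat \<Rightarrow> real) \<Rightarrow> (nat \<Rightarrow> real) \<Rightarrow> bool" (infix "\<succeq>" 50) where
  "a \<succeq> b \<longleftrightarrow> antimono_on {1..} (\<lambda>k. b k / a k)"

definition maximal_seq :: "((nat \<Rightarrow> real) \<Rightarrow> bool) \<Rightarrow> (nat \<Rightarrow> real) \<Rightarrow> bool" where
  "maximal_seq C g \<longleftrightarrow> pos_seq g \<and> C g \<and> (\<forall>a. pos_seq a \<and> C a \<longrightarrow> g \<succeq> a)"

definition sine_cond :: "(nat \<Rightarrow> real) \<Rightarrow> bool" where
  "sine_cond a \<longleftrightarrow> (\<forall>j\<ge>1.
     a (2 * j - 1) \<ge> (2 * real j) / (2 * real j - 1) * a (2 * j) \<and>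
     a (2 * j) \<ge> (2 * real j + 1) / (2 * real j + 2) * a (2 * j + 1))"

definition gamma_seq :: "nat \<Rightarrow> real" where
  "gamma_seq k = (if odd k then (real k + 1) / real k else 1)"

end

theory Submission
  imports Defs "HOL-Analysis.Complex_Transcendental"
begin

text \<open>
  Writing \<open>a k = c k * gamma_seq k\<close>, the two inequalities on \<open>a\<close> say precisely that \<open>c\<close> is
  non-increasing, because \<open>gamma_seq\<close> satisfies both with equality. This is the maximality claim,
  and by Abel summation it reduces the nonnegativity claim to the single sequence \<open>gamma_seq\<close>.

  Since \<open>gamma_seq k\<close> is \<open>1\<close>, plus \<open>1 / k\<close> for odd \<open>k\<close>, the \<open>n\<close>-th partial sum for \<open>gamma_seq\<close> is
  the conjugate Dirichlet kernel \<open>\<Sum>k=1..n. sin (k * x)\<close> plus \<open>odd_sine_sum m x\<close>, where \<open>m\<close> is the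
  number of odd \<open>k \<le> n\<close>. Three ranges of \<open>x\<close> are distinguished.
  For \<open>x \<le> pi / (2 * m)\<close> every summand is nonnegative.
  For \<open>x \<ge> pi - pi / (2 * m)\<close> the summands \<open>2 * j - 1\<close> and \<open>2 * j\<close> nearly cancel, and
  their sum is nonnegative because \<open>sin t / t\<close> decreases on \<open>[0, pi]\<close>.
  In between, the conjugate kernel is at least \<open>- 1 / 2\<close> (closed form), and the odd sum is at
  least \<open>1 / 2\<close> (\<open>odd_sine_sum_ge_half\<close>).

  The last bound is the heart of the matter. Summation by parts gives
  \<open>sin y * odd_sine_sum m y\<close> as a sum of nonnegative multiples of the squares \<open>(sin (j * y))\<^sup>2\<close>,
  so that terms may be dropped. For \<open>y\<close> not too small the terms \<open>j = 1, 2\<close> are enough; for small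
  \<open>y\<close> all \<open>j \<le> pi / (2 * y)\<close> are kept, and \<open>sin t \<ge> t - t ^ 3 / 6\<close> turns the sum
  into an explicit rational expression.
\<close>

section \<open>Elementary sine inequalities\<close>

lemma sin_ge_cubic:
  fixes t :: real
  assumes "0 \<le> t" "t \<le> pi / 2"
  shows "t - t ^ 3 / 6 \<le> sin t"
proof (cases "t = 0")
  case False
  with assms obtain u where u: "0 < u" "u < t"
    and eq: "sin t = (\<Sum>m<5. sin_coeff m * t ^ m) + sin (u + 1/2 * real 5 * pi) / fact 5 * t ^ 5"
    using Maclaurin_sin_expansion3[of 5 t] by auto
  have "sin (u + 1/2 * real 5 * pi) = sin ((u + pi / 2) + 2 * pi)"
    by (simp add: algebra_simps)
  also have "\<dots> = cos u"
    by (simp only: sin_periodic) (simp add: sin_add)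
  finally have "sin (u + 1/2 * real 5 * pi) = cos u" .
  moreover have "0 \<le> cos u"
    using u assms by (intro cos_ge_zero) auto
  moreover have "(\<Sum>m<5. sin_coeff m * t ^ m) = t - t ^ 3 / 6"
  proof -
    have "{..<5} = {0, 1, 2, 3, 4 :: nat}"
      by auto
    thus ?thesis
      by (simp add: sin_coeff_def fact_numeral)
  qed
  ultimately show ?thesis
    using eq assms by simp
qed simp

lemma sin_squared_ge:
  fixes t :: real
  assumes "0 \<le> t" "t \<le> pi / 2"
  shows "t ^ 2 - t ^ 4 / 3 \<le> (sin t) ^ 2"
proof -
  have "t \<le> 2"
    using assms pi_less_4 by simp
  hence "t ^ 2 \<le> 2 ^ 2"
    using assms by (intro power_mono) auto
  hence "0 \<le> t * (1 - t ^ 2 / 6)"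
    using assms by (intro mult_nonneg_nonneg) auto
  hence "0 \<le> t - t ^ 3 / 6"
    by (simp add: algebra_simps eval_nat_numeral)
  hence "(t - t ^ 3 / 6) ^ 2 \<le> (sin t) ^ 2"
    using sin_ge_cubic[OF assms] by (intro power_mono) auto
  moreover have "(t - t ^ 3 / 6) ^ 2 = t ^ 2 - t ^ 4 / 3 + (t ^ 3) ^ 2 / 36"
    by (simp add: power2_eq_square field_simps eval_nat_numeral)
  moreover have "0 \<le> (t ^ 3) ^ 2 / 36"
    by simp
  ultimately show ?thesis
    by linarith
qed

text \<open>
  This is the monotonicity of \<open>sin t / t\<close> on the multiples of \<open>y\<close>. It follows by induction because
  the difference of the two sides grows by \<open>2 * k * sin (k * y) * (1 - cos y)\<close> at each step.
\<close>

lemma sin_multiple_ratio_decreasing: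
  fixes y :: real
  assumes "0 \<le> y" "real (Suc k) * y \<le> pi"
  shows "real k * sin (real (Suc k) * y) \<le> real (Suc k) * sin (real k * y)"
  using assms(2)
proof (induction k)
  case (Suc k)
  have le: "real (Suc k) * y \<le> pi"
    using Suc.prems assms(1) by (simp add: algebra_simps)
  have "0 \<le> sin (real (Suc k) * y) * (1 - cos y)"
    using le assms(1) by (intro mult_nonneg_nonneg sin_ge_zero) auto
  hence "0 \<le> 2 * real (Suc k) * (sin (real (Suc k) * y) * (1 - cos y))"
    by (rule mult_nonneg_nonneg[rotated]) simp
  moreover have "sin (real (Suc (Suc k)) * y) + sin (real k * y) = 2 * sin (real (Suc k) * y) * cos y"
  proof -
    have "real (Suc (Suc k)) * y = real (Suc k) * y + y" "real k * y = real (Suc k) * y - y"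
      by (simp_all add: algebra_simps)
    thus ?thesis
      by (simp only: sin_add sin_diff)
  qed
  hence "real (Suc k) * (sin (real (Suc (Suc k)) * y) + sin (real k * y))
      = real (Suc k) * (2 * sin (real (Suc k) * y) * cos y)"
    by simp
  ultimately show ?case
    using Suc.IH[OF le] by (simp add: algebra_simps)
qed simp

section \<open>The odd part of the sum\<close>

definition odd_sine_sum :: "nat \<Rightarrow> real \<Rightarrow> real" where
  "odd_sine_sum m x = (\<Sum>j=1..m. sin ((2 * real j - 1) * x) / (2 * real j - 1))"

lemma sin_odd_multiple_reflect: "sin ((2 * real j - 1) * (pi - y)) = sin ((2 * real j - 1) * y)"
proof -
  have "(2 * real j - 1) * (pi - y) = 2 * real j * pi - pi - (2 * real j - 1) * y"
    by (simp add: algebra_simps)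
  moreover have "sin (2 * real j * pi) = 0" "cos (2 * real j * pi) = 1"
    using sin_2npi[of j] cos_2npi[of j] by simp_all
  ultimately show ?thesis
    by (simp add: sin_diff cos_diff)
qed

lemma sin_even_multiple_reflect: "sin (2 * real j * (pi - y)) = - sin (2 * real j * y)"
proof -
  have "2 * real j * (pi - y) = 2 * real j * pi - 2 * real j * y"
    by (simp add: algebra_simps)
  moreover have "sin (2 * real j * pi) = 0" "cos (2 * real j * pi) = 1"
    using sin_2npi[of j] cos_2npi[of j] by simp_all
  ultimately show ?thesis
    by (simp add: sin_diff)
qed

lemma odd_sine_sum_reflect: "odd_sine_sum m (pi - y) = odd_sine_sum m y"
  by (simp only: odd_sine_sum_def sin_odd_multiple_reflect)

text \<open>
  Summation by parts with \<open>sin y * sin ((2 * j - 1) * y) = (sin (j * y))\<^sup>2 - (sin ((j - 1) * y))\<^sup>2\<close>.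
  The weights \<open>2 / (4 * j\<^sup>2 - 1)\<close> are the differences of consecutive values of \<open>1 / (2 * j - 1)\<close>.
\<close>

lemma sin_times_odd_sine_sum:
  "sin y * odd_sine_sum m y =
     (\<Sum>j=1..m. 2 / (4 * real j ^ 2 - 1) * (sin (real j * y)) ^ 2)
     + (sin (real m * y)) ^ 2 / (2 * real m + 1)"
proof (induction m)
  case 0
  show ?case by (simp add: odd_sine_sum_def)
next
  case (Suc m)
  define A B where "A = (sin (real m * y)) ^ 2" and "B = (sin (real (Suc m) * y)) ^ 2"
  have prod: "sin y * sin ((2 * real (Suc m) - 1) * y) = B - A"
  proof -
    have 1: "(2 * real (Suc m) - 1) * y = real m * y + real (Suc m) * y"
      and 2: "y = real (Suc m) * y - real m * y"
      by (simp_all add: algebra_simps)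
    define u v where "u = real (Suc m) * y" and "v = real m * y"
    have "sin y * sin ((2 * real (Suc m) - 1) * y) = sin (u - v) * sin (v + u)"
      using 1 2 by (simp add: u_def v_def)
    also have "\<dots> = (sin u) ^ 2 * (cos v) ^ 2 - (cos u) ^ 2 * (sin v) ^ 2"
      by (simp add: sin_add sin_diff power2_eq_square algebra_simps)
    also have "\<dots> = (sin u) ^ 2 - (sin v) ^ 2"
      by (simp add: cos_squared_eq algebra_simps)
    finally show ?thesis
      by (simp add: A_def B_def u_def v_def)
  qed
  have weight: "2 / (4 * real (Suc m) ^ 2 - 1) = 1 / (2 * real m + 1) - 1 / (2 * real m + 3)"
  proof -
    have "4 * real (Suc m) ^ 2 - 1 = (2 * real m + 1) * (2 * real m + 3)"
      by (simp add: power2_eq_square algebra_simps)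
    thus ?thesis
      by (simp add: field_simps)
  qed
  have "sin y * odd_sine_sum (Suc m) y
      = sin y * odd_sine_sum m y + (B - A) / (2 * real m + 1)"
    using prod by (simp add: odd_sine_sum_def algebra_simps)
  also have "\<dots> = (\<Sum>j=1..m. 2 / (4 * real j ^ 2 - 1) * (sin (real j * y)) ^ 2)
      + B / (2 * real m + 1)"
    unfolding Suc.IH A_def[symmetric] by (simp add: diff_divide_distrib)
  also have "B / (2 * real m + 1) = 2 / (4 * real (Suc m) ^ 2 - 1) * B + B / (2 * real (Suc m) + 1)"
    unfolding weight by (simp add: algebra_simps)
  finally show ?case
    by (simp add: B_def)
qed

lemma sin_times_odd_sine_sum_ge:
  assumes "J \<le> m"
  shows "(\<Sum>j=1..J. 2 / (4 * real j ^ 2 - 1) * (sin (real j * y)) ^ 2) \<le> sin y * odd_sine_sum m y"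
proof -
  have "(\<Sum>j=1..J. 2 / (4 * real j ^ 2 - 1) * (sin (real j * y)) ^ 2)
      \<le> (\<Sum>j=1..m. 2 / (4 * real j ^ 2 - 1) * (sin (real j * y)) ^ 2)"
  proof (rule sum_mono2)
    fix j assume "j \<in> {1..m} - {1..J}"
    hence "1 ^ 2 \<le> real j ^ 2"
      by (intro power_mono) auto
    thus "0 \<le> 2 / (4 * real j ^ 2 - 1) * (sin (real j * y)) ^ 2"
      by (intro mult_nonneg_nonneg divide_nonneg_nonneg) auto
  qed (use assms in auto)
  thus ?thesis
    unfolding sin_times_odd_sine_sum by (simp add: add_increasing2)
qed

text \<open>
  The bound \<open>sin_squared_ge\<close> applied to each square; the weighted power sums on the way are
  \<open>\<Sum>j\<le>J. 2 * j\<^sup>2 / (4 * j\<^sup>2 - 1) = J * (J + 1) / (2 * J + 1)\<close> and its analogue for \<open>j ^ 4\<close>.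
\<close>

lemma weighted_sin_squares_ge:
  fixes y :: real
  assumes "0 \<le> y" "real J * y \<le> pi / 2"
  shows "y ^ 2 * (real J * (real J + 1) / (2 * real J + 1))
           * (1 - y ^ 2 * (real J ^ 2 + real J + 1) / 9)
         \<le> (\<Sum>j=1..J. 2 / (4 * real j ^ 2 - 1) * (sin (real j * y)) ^ 2)"
  using assms(2)
proof (induction J)
  case (Suc J)
  define z where "z = real J"
  have z: "0 \<le> z" "real (Suc J) = z + 1"
    by (simp_all add: z_def)
  have "real J * y \<le> pi / 2"
    using Suc.prems assms(1) by (simp add: algebra_simps)
  note IH = Suc.IH[OF this, folded z_def]
  have w: "4 * (z + 1) ^ 2 - 1 = (2 * z + 1) * (2 * z + 3)"
    by (simp add: power2_eq_square algebra_simps)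
  have "((z + 1) * y) ^ 2 - ((z + 1) * y) ^ 4 / 3 \<le> (sin ((z + 1) * y)) ^ 2"
    using Suc.prems assms(1) unfolding z(2) by (intro sin_squared_ge) (auto simp: z(1))
  hence last: "2 / (4 * (z + 1) ^ 2 - 1) * (((z + 1) * y) ^ 2 - ((z + 1) * y) ^ 4 / 3)
      \<le> 2 / (4 * (z + 1) ^ 2 - 1) * (sin ((z + 1) * y)) ^ 2"
    using z(1) unfolding w by (intro mult_left_mono) auto
  have nz: "2 * z + 1 \<noteq> 0" "2 * z + 3 \<noteq> 0"
    using z(1) by auto
  have "y ^ 2 * ((z + 1) * (z + 1 + 1) / (2 * (z + 1) + 1))
        * (1 - y ^ 2 * ((z + 1) ^ 2 + (z + 1) + 1) / 9)
      = y ^ 2 * (z * (z + 1) / (2 * z + 1)) * (1 - y ^ 2 * (z ^ 2 + z + 1) / 9)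
        + 2 / (4 * (z + 1) ^ 2 - 1) * (((z + 1) * y) ^ 2 - ((z + 1) * y) ^ 4 / 3)"
  proof -
    have d: "2 * (z + 1) + 1 = 2 * z + 3" by simp
    show ?thesis
      unfolding w d using nz
      by (simp add: divide_simps) algebra
  qed
  thus ?case
    using IH last unfolding sum.cl_ivl_Suc z(2) by simp
qed simp

text \<open>
  With \<open>r = (J + 1 / 2) * y\<close>, the lower bound in \<open>weighted_sin_squares_ge\<close> is the right-hand side
  divided by \<open>2 * J + 1\<close>, while \<open>r / (2 * J + 1) = y / 2\<close>. So this is what makes
  that lower bound at least \<open>y / 2\<close>.
\<close>

lemma rational_bound:
  fixes r y :: real
  assumes "133 / 100 \<le> r" "r \<le> 182 / 100" "0 \<le> y" "y \<le> 12 / 25"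
  shows "r \<le> (r ^ 2 - y ^ 2 / 4) * (1 - r ^ 2 / 9 - y ^ 2 / 12)"
proof -
  have y2: "y ^ 2 \<le> (12 / 25) ^ 2"
    using assms by (intro power_mono) auto
  have r2: "(133 / 100) ^ 2 \<le> r ^ 2" "r ^ 2 \<le> (182 / 100) ^ 2"
    using assms by (auto intro!: power_mono)
  have "(r ^ 2 - 36 / 625) * (613 / 625 - r ^ 2 / 9)
      \<le> (r ^ 2 - y ^ 2 / 4) * (1 - r ^ 2 / 9 - y ^ 2 / 12)"
    using y2 r2 by (intro mult_mono) (simp_all add: power2_eq_square)
  moreover have "r \<le> (r ^ 2 - 36 / 625) * (613 / 625 - r ^ 2 / 9)"
  proof -
    \<comment> \<open>The quadratic factor is the quotient on division of the quartic by \<open>(r - 1.33) * (1.82 - r)\<close>,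
      rounded; what remains is positive on the interval.\<close>
    have "0 \<le> (r - 133 / 100) * (182 / 100 - r) * (r ^ 2 / 9 + 35 / 100 * r - 16 / 100)"
      using assms r2 by (intro mult_nonneg_nonneg) (simp_all add: power2_eq_square)
    also have "\<dots> = - (r ^ 4) / 9 + (12625 / 10000 - 24206 / 90000) * r ^ 2
        - 135121 / 100000 * r + 387296 / 1000000"
      by (simp add: field_simps eval_nat_numeral)
    finally have "r ^ 4 / 9 \<le> (12625 / 10000 - 24206 / 90000) * r ^ 2
        - 135121 / 100000 * r + 387296 / 1000000"
      by simp
    moreover have "(r ^ 2 - 36 / 625) * (613 / 625 - r ^ 2 / 9)
        = (613 / 625 + 4 / 625) * r ^ 2 - r ^ 4 / 9 - 36 / 625 * (613 / 625)"
      by (simp add: field_simps eval_nat_numeral)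
    ultimately show ?thesis
      using assms r2 by (simp add: power2_eq_square)
  qed
  ultimately show ?thesis
    by linarith
qed

text \<open>
  The bound on \<open>(sin (j * y))\<^sup>2\<close> needs \<open>j * y \<le> pi / 2\<close>, and \<open>J\<close> is the largest such \<open>j\<close>; the lower
  bound on \<open>y\<close> guarantees \<open>J \<le> m\<close>, so these terms are all present. Then \<open>(J + 1 / 2) * y\<close>
  differs from \<open>pi / 2\<close> by at most \<open>y / 2 \<le> 6 / 25\<close>, which gives the interval of \<open>rational_bound\<close>.
\<close>

lemma odd_sine_sum_ge_half_small:
  fixes y :: real
  assumes "0 < y" "y \<le> 12 / 25" "pi / (2 * real m) \<le> y" "1 \<le> m"
  shows "1 / 2 \<le> odd_sine_sum m y"
proof -
  define J where "J = nat \<lfloor>pi / (2 * y)\<rfloor>"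
  have J: "real J \<le> pi / (2 * y)" "pi / (2 * y) < real J + 1"
    using assms(1) unfolding J_def by auto
  have "pi / (2 * y) \<le> real m"
    using assms by (simp add: field_simps)
  hence "real J \<le> real m"
    using J(1) by linarith
  hence "J \<le> m"
    by simp
  have Jy: "real J * y \<le> pi / 2" "pi / 2 < real J * y + y"
    using J assms(1) by (simp_all add: field_simps)
  define r where "r = (real J + 1 / 2) * y"
  have r: "133 / 100 \<le> r" "r \<le> 182 / 100"
    using Jy pi_approx assms(2) unfolding r_def by (simp_all add: algebra_simps)
  have bound: "r \<le> (r ^ 2 - y ^ 2 / 4) * (1 - r ^ 2 / 9 - y ^ 2 / 12)"
    using r assms by (intro rational_bound) auto
  have sq: "r ^ 2 - y ^ 2 / 4 = y ^ 2 * (real J * (real J + 1))"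
    "1 - r ^ 2 / 9 - y ^ 2 / 12 = 1 - y ^ 2 * (real J ^ 2 + real J + 1) / 9"
    by (simp_all add: r_def power2_eq_square field_simps)
  have "y / 2 = r / (2 * real J + 1)"
    by (simp add: r_def field_simps)
  also have "\<dots> \<le> (r ^ 2 - y ^ 2 / 4) * (1 - r ^ 2 / 9 - y ^ 2 / 12) / (2 * real J + 1)"
    using bound by (intro divide_right_mono) auto
  also have "\<dots> = y ^ 2 * (real J * (real J + 1) / (2 * real J + 1))
           * (1 - y ^ 2 * (real J ^ 2 + real J + 1) / 9)"
    unfolding sq by simp
  also have "\<dots> \<le> sin y * odd_sine_sum m y"
    using weighted_sin_squares_ge[of y J] sin_times_odd_sine_sum_ge[OF \<open>J \<le> m\<close>, of y]
      Jy(1) assms(1) by linarith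
  finally have "y / 2 \<le> sin y * odd_sine_sum m y" .
  moreover have "sin y \<le> y"
    using assms(1) by (intro sin_x_le_x) auto
  ultimately have "sin y * (1 / 2) \<le> sin y * odd_sine_sum m y"
    by linarith
  moreover have "0 < sin y"
    using assms pi_approx by (intro sin_gt_zero) auto
  ultimately show ?thesis
    by (simp only: mult_le_cancel_left_pos)
qed

text \<open>
  The terms \<open>j = 1, 2\<close> give the bound \<open>(6 / 5) * s - (8 / 15) * s ^ 3\<close> with \<open>s = sin y\<close>, which is at least
  \<open>1 / 2\<close> on \<open>[23 / 50, 1]\<close>.
\<close>

lemma odd_sine_sum_ge_half_large:
  fixes y :: real
  assumes "12 / 25 \<le> y" "y \<le> pi / 2" "2 \<le> m"
  shows "1 / 2 \<le> odd_sine_sum m y"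
proof -
  define s where "s = sin y"
  have "sin (12 / 25) \<le> s"
    using assms pi_approx unfolding s_def by (intro sin_monotone_2pi_le) auto
  moreover have "12 / 25 - (12 / 25) ^ 3 / 6 \<le> sin (12 / 25 :: real)"
    using pi_approx by (intro sin_ge_cubic) auto
  ultimately have s: "23 / 50 \<le> s" "s \<le> 1"
    by (simp_all add: s_def eval_nat_numeral)
  have dbl: "(sin (2 * y)) ^ 2 = 4 * s ^ 2 * (1 - s ^ 2)"
    by (simp add: sin_double s_def power_mult_distrib cos_squared_eq)
  have "s * (s * (6 / 5 - 8 / 15 * s ^ 2))
      = (\<Sum>j=1..2. 2 / (4 * real j ^ 2 - 1) * (sin (real j * y)) ^ 2)"
    using dbl by (simp add: eval_nat_numeral s_def[symmetric] field_simps)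
  also have "\<dots> \<le> s * odd_sine_sum m y"
    unfolding s_def using assms by (intro sin_times_odd_sine_sum_ge) auto
  finally have "s * (6 / 5 - 8 / 15 * s ^ 2) \<le> odd_sine_sum m y"
    using s by (simp add: mult_le_cancel_left_pos)
  moreover have "1 / 2 \<le> s * (6 / 5 - 8 / 15 * s ^ 2)"
  proof -
    \<comment> \<open>By concavity the cubic lies above its chord over \<open>[23 / 50, 1]\<close>; the product is
      \<open>15 / 8\<close> times the difference.\<close>
    have "0 \<le> (s - 23 / 50) * (1 - s) * (s + 73 / 50)"
      using s by (intro mult_nonneg_nonneg) auto
    also have "\<dots> = 4179 / 2500 * s - 1679 / 2500 - s ^ 3"
      by (simp add: field_simps eval_nat_numeral)
    finally have "s ^ 3 \<le> 4179 / 2500 * s - 1679 / 2500"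
      by simp
    moreover have "s * (6 / 5 - 8 / 15 * s ^ 2) = 6 / 5 * s - 8 / 15 * s ^ 3"
      by (simp add: field_simps eval_nat_numeral)
    ultimately show ?thesis
      using s by linarith
  qed
  ultimately show ?thesis
    by linarith
qed

lemma odd_sine_sum_ge_half_first_quadrant:
  assumes "1 \<le> m" "pi / (2 * real m) \<le> y" "y \<le> pi / 2"
  shows "1 / 2 \<le> odd_sine_sum m y"
proof -
  have "0 < y"
    using assms by (intro less_le_trans[OF _ assms(2)]) auto
  consider "m = 1" | "2 \<le> m" "12 / 25 \<le> y" | "y \<le> 12 / 25"
    using assms(1) by linarith
  thus ?thesis
  proof cases
    case 1
    hence "y = pi / 2"
      using assms by simp
    show ?thesis
      unfolding 1 \<open>y = pi / 2\<close> by (simp add: odd_sine_sum_def)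
  next
    case 2
    thus ?thesis
      using assms by (intro odd_sine_sum_ge_half_large)
  next
    case 3
    thus ?thesis
      using assms \<open>0 < y\<close> by (intro odd_sine_sum_ge_half_small)
  qed
qed

lemma odd_sine_sum_ge_half:
  assumes "1 \<le> m" "pi / (2 * real m) \<le> x" "x \<le> pi - pi / (2 * real m)"
  shows "1 / 2 \<le> odd_sine_sum m x"
proof (cases "x \<le> pi / 2")
  case True
  thus ?thesis
    using assms by (intro odd_sine_sum_ge_half_first_quadrant)
next
  case False
  hence "1 / 2 \<le> odd_sine_sum m (pi - x)"
    using assms by (intro odd_sine_sum_ge_half_first_quadrant) auto
  thus ?thesis
    by (simp only: odd_sine_sum_reflect)
qed

section \<open>The conjugate Dirichlet kernel\<close>

lemma sine_sum_closed_form: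
  "2 * sin (x / 2) * (\<Sum>k=1..n. sin (real k * x)) = cos (x / 2) - cos ((real n + 1 / 2) * x)"
proof (induction n)
  case (Suc n)
  have "2 * sin (x / 2) * sin (real (Suc n) * x)
      = cos (real (Suc n) * x - x / 2) - cos (real (Suc n) * x + x / 2)"
    by (simp only: cos_add cos_diff) simp
  also have "real (Suc n) * x - x / 2 = (real n + 1 / 2) * x"
    by (simp add: field_simps)
  also have "real (Suc n) * x + x / 2 = (real (Suc n) + 1 / 2) * x"
    by (simp add: field_simps)
  finally show ?case
    using Suc.IH by (simp add: distrib_left)
qed simp

text \<open>The closed form is at least \<open>cos (x / 2) - 1\<close>, and \<open>sin + cos \<ge> 1\<close> in the first quadrant.\<close>

lemma sine_sum_ge_minus_half:
  fixes x :: real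
  assumes "0 < x" "x < pi"
  shows "- 1 / 2 \<le> (\<Sum>k=1..n. sin (real k * x))"
proof -
  define S where "S = (\<Sum>k=1..n. sin (real k * x))"
  define s c where "s = sin (x / 2)" and "c = cos (x / 2)"
  have pos: "0 < s" "0 \<le> c"
    using assms unfolding s_def c_def by (auto intro!: sin_gt_zero cos_ge_zero)
  have le1: "s \<le> 1" "c \<le> 1"
    by (simp_all add: s_def c_def)
  have "s ^ 2 + c ^ 2 = 1"
    by (simp add: s_def c_def)
  moreover have "s ^ 2 \<le> s" "c ^ 2 \<le> c"
    using pos le1 by (auto simp: power2_eq_square intro: mult_left_le)
  ultimately have "1 \<le> s + c"
    by linarith
  moreover have "2 * s * S \<ge> c - 1"
    unfolding s_def S_def c_def sine_sum_closed_form by simp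
  ultimately have "0 \<le> s * (2 * S + 1)"
    by (simp add: algebra_simps)
  hence "0 \<le> 2 * S + 1"
    using pos(1) by (simp add: zero_le_mult_iff)
  thus ?thesis
    by (simp add: S_def)
qed

section \<open>Partial sums of the extremal series\<close>

abbreviation gamma_sum :: "nat \<Rightarrow> real \<Rightarrow> real" where
  "gamma_sum n x \<equiv> (\<Sum>k=1..n. gamma_seq k * sin (real k * x))"

lemma gamma_seq_double [simp]: "gamma_seq (2 * j) = 1"
  by (simp add: gamma_seq_def)

lemma gamma_seq_double_plus_1: "gamma_seq (2 * j + 1) = (2 * real j + 2) / (2 * real j + 1)"
  by (simp add: gamma_seq_def add.commute)

lemma gamma_seq_pos: "1 \<le> k \<Longrightarrow> 0 < gamma_seq k"
  by (auto simp: gamma_seq_def)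

lemma gamma_sum_double:
  "gamma_sum (2 * m) x = (\<Sum>k=1..2*m. sin (real k * x)) + odd_sine_sum m x"
proof (induction m)
  case (Suc m)
  have "gamma_seq (Suc (2 * m)) = 1 + 1 / (2 * real m + 1)"
    by (simp add: gamma_seq_def field_simps)
  thus ?case
    using Suc.IH by (simp add: gamma_seq_def odd_sine_sum_def algebra_simps)
qed (simp add: odd_sine_sum_def)

lemma gamma_sum_predouble:
  fixes x :: real
  assumes "1 \<le> m"
  shows "gamma_sum (2 * m) x = gamma_sum (2 * m - 1) x + sin (2 * real m * x)"
proof -
  obtain k where "m = Suc k"
    using assms by (cases m) auto
  thus ?thesis
    by (simp add: gamma_seq_def)
qed

lemma gamma_sum_eq:
  fixes x :: real
  assumes "1 \<le> m" "n = 2 * m \<or> n = 2 * m - 1"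
  shows "gamma_sum n x = (\<Sum>k=1..n. sin (real k * x)) + odd_sine_sum m x"
proof -
  obtain k where k: "m = Suc k"
    using assms by (cases m) auto
  have "(\<Sum>k=1..2*m. sin (real k * x)) = (\<Sum>k=1..2*m-1. sin (real k * x)) + sin (2 * real m * x)"
    by (simp add: k)
  thus ?thesis
    using assms(2) gamma_sum_double[where m = m and x = x] gamma_sum_predouble[OF assms(1), of x] by auto
qed

lemma gamma_sum_nonneg_near_0:
  assumes "0 \<le> x" "real n * x \<le> pi"
  shows "0 \<le> gamma_sum n x"
proof (rule sum_nonneg)
  fix k assume k: "k \<in> {1..n}"
  have "real k * x \<le> real n * x"
    using k assms by (intro mult_right_mono) auto
  hence "0 \<le> sin (real k * x)"
    using assms by (intro sin_ge_zero) auto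
  thus "0 \<le> gamma_seq k * sin (real k * x)"
    using k gamma_seq_pos[of k] by simp
qed

lemma gamma_sum_double_nonneg_near_pi:
  assumes "0 \<le> y" "2 * real m * y \<le> pi"
  shows "0 \<le> gamma_sum (2 * m) (pi - y)"
  using assms(2)
proof (induction m)
  case (Suc m)
  let ?k = "2 * m + 1"
  have le: "real (Suc ?k) * y \<le> pi"
    using Suc.prems by simp
  have "2 * real m * y \<le> pi"
    using Suc.prems assms(1) by (simp add: algebra_simps)
  note IH = Suc.IH[OF this]
  have "gamma_sum (2 * Suc m) (pi - y) = gamma_sum (2 * m) (pi - y)
      + gamma_seq ?k * sin (real ?k * (pi - y)) + sin (real (Suc ?k) * (pi - y))"
    by (simp add: gamma_seq_def)
  also have "sin (real ?k * (pi - y)) = sin (real ?k * y)"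
    using sin_odd_multiple_reflect[of "Suc m" y] by (simp add: add.commute)
  also have "sin (real (Suc ?k) * (pi - y)) = - sin (real (Suc ?k) * y)"
    using sin_even_multiple_reflect[of "Suc m" y] by (simp add: add.commute)
  also have "gamma_seq ?k = real (Suc ?k) / real ?k"
    by (simp add: gamma_seq_def)
  finally have eq: "gamma_sum (2 * Suc m) (pi - y) = gamma_sum (2 * m) (pi - y)
      + real (Suc ?k) / real ?k * sin (real ?k * y) - sin (real (Suc ?k) * y)"
    by simp
  have "sin (real (Suc ?k) * y) = real ?k * sin (real (Suc ?k) * y) / real ?k"
    by simp
  also have "\<dots> \<le> real (Suc ?k) * sin (real ?k * y) / real ?k"
    by (intro divide_right_mono sin_multiple_ratio_decreasing[OF assms(1) le]) simp
  also have "\<dots> = real (Suc ?k) / real ?k * sin (real ?k * y)"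
    by simp
  finally show ?case
    using IH eq by linarith
qed simp

lemma gamma_sum_nonneg:
  assumes "1 \<le> n" "0 \<le> x" "x \<le> pi"
  shows "0 \<le> gamma_sum n x"
proof -
  define m where "m = (n + 1) div 2"
  have m: "1 \<le> m" "n = 2 * m \<or> n = 2 * m - 1"
    using assms(1) unfolding m_def by presburger+
  consider "x \<le> pi / (2 * real m)" | "pi - pi / (2 * real m) \<le> x"
    | "pi / (2 * real m) < x" "x < pi - pi / (2 * real m)"
    by linarith
  thus ?thesis
  proof cases
    case 1
    have "real n * x \<le> real (2 * m) * x"
      using m assms by (intro mult_right_mono) auto
    also have "\<dots> \<le> pi"
      using 1 m by (simp add: field_simps)
    finally show ?thesis
      using assms by (intro gamma_sum_nonneg_near_0)
  next
    case 2
    define y where "y = pi - x"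
    have y: "0 \<le> y" "2 * real m * y \<le> pi"
      using 2 m assms by (simp_all add: y_def field_simps)
    have even: "0 \<le> gamma_sum (2 * m) x"
      using gamma_sum_double_nonneg_near_pi[OF y] by (simp add: y_def)
    \<comment> \<open>Dropping the last summand of an even sum only helps here, as that summand is \<open>\<le> 0\<close>.\<close>
    have "sin (2 * real m * x) \<le> 0"
      using sin_even_multiple_reflect[of m y] sin_ge_zero[of "2 * real m * y"] y
      by (simp add: y_def)
    thus ?thesis
      using m(2) even gamma_sum_predouble[OF m(1), of x] by auto
  next
    case 3
    have "0 < pi / (2 * real m)"
      using m by simp
    hence "0 < x" "x < pi"
      using 3 by linarith+
    hence "- 1 / 2 \<le> (\<Sum>k=1..n. sin (real k * x))"
      by (rule sine_sum_ge_minus_half)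
    moreover have "1 / 2 \<le> odd_sine_sum m x"
      using 3 m by (intro odd_sine_sum_ge_half) auto
    ultimately show ?thesis
      using gamma_sum_eq[OF m, of x] by linarith
  qed
qed

section \<open>Comparison with the extremal sequence\<close>

text \<open>
  Abel's inequality. The induction needs the stronger lower bound by the last coefficient times the
  full partial sum.
\<close>

lemma antimono_weighted_sum_nonneg:
  fixes c g :: "nat \<Rightarrow> real"
  assumes "antimono_on {1..} c" and "\<And>k. 1 \<le> k \<Longrightarrow> 0 \<le> c k"
    and "\<And>n. 1 \<le> n \<Longrightarrow> 0 \<le> (\<Sum>k=1..n. g k)" and "1 \<le> n"
  shows "0 \<le> (\<Sum>k=1..n. c k * g k)"
proof -
  have "c n * (\<Sum>k=1..n. g k) \<le> (\<Sum>k=1..n. c k * g k)"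
    using \<open>1 \<le> n\<close>
  proof (induction n rule: dec_induct)
    case (step n)
    have "c (Suc n) \<le> c n"
      using step by (intro monotone_onD[OF assms(1)]) auto
    hence "c (Suc n) * (\<Sum>k=1..n. g k) \<le> c n * (\<Sum>k=1..n. g k)"
      using assms(3) step by (intro mult_right_mono) auto
    thus ?case
      using step by (simp add: distrib_left)
  qed simp
  moreover have "0 \<le> c n * (\<Sum>k=1..n. g k)"
    using assms by simp
  ultimately show ?thesis
    by linarith
qed

lemma sine_cond_gamma_seq: "sine_cond gamma_seq"
  unfolding sine_cond_def
proof (intro allI impI)
  fix j :: nat assume j: "1 \<le> j"
  hence "gamma_seq (2 * j - 1) = 2 * real j / (2 * real j - 1)"
    by (simp add: gamma_seq_def of_nat_diff)
  thus "gamma_seq (2 * j - 1) \<ge> (2 * real j) / (2 * real j - 1) * gamma_seq (2 * j) \<and>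
     gamma_seq (2 * j) \<ge> (2 * real j + 1) / (2 * real j + 2) * gamma_seq (2 * j + 1)"
    unfolding gamma_seq_double_plus_1 by simp
qed

lemma gamma_seq_succeq:
  assumes "sine_cond a"
  shows "gamma_seq \<succeq> a"
proof -
  have ratio_step: "a (Suc k) / gamma_seq (Suc k) \<le> a k / gamma_seq k" if "1 \<le> k" for k
  proof (cases "even k")
    case True
    then obtain j where k: "k = 2 * j"
      by (elim evenE)
    hence j: "1 \<le> j"
      using that by simp
    have "a (Suc k) / gamma_seq (Suc k) = (2 * real j + 1) / (2 * real j + 2) * a (2 * j + 1)"
      by (simp add: k gamma_seq_double_plus_1[simplified])
    thus ?thesis
      using assms j by (simp add: k sine_cond_def)
  next
    case False
    then obtain i where i: "k = 2 * i + 1"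
      by (auto elim!: oddE)
    define j where "j = Suc i"
    have k: "k = 2 * j - 1" "Suc k = 2 * j" and j: "1 \<le> j"
      by (simp_all add: i j_def)
    have rk: "real k = 2 * real j - 1" and pos: "0 < 2 * real j - 1" "0 < real j"
      by (simp_all add: i j_def)
    have "2 * real j / (2 * real j - 1) * a (Suc k) \<le> a k"
      using assms j by (simp only: k(2)) (simp add: sine_cond_def k(1))
    hence "a (Suc k) \<le> a k / (2 * real j / (2 * real j - 1))"
      using pos by (simp add: field_simps)
    thus ?thesis
      using False rk by (simp add: gamma_seq_def)
  qed
  show ?thesis
    unfolding seq_succeq_def
  proof (rule monotone_onI)
    fix m n :: nat assume "m \<in> {1..}" and "m \<le> n"
    from \<open>m \<le> n\<close> show "a n / gamma_seq n \<le> a m / gamma_seq m"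
    proof (induction n rule: dec_induct)
      case (step n)
      have "1 \<le> n"
        using \<open>m \<in> {1..}\<close> step.hyps by simp
      from ratio_step[OF this] step.IH show ?case
        by (rule order_trans)
    qed simp
  qed
qed

lemma sine_cond_PS:
  assumes "pos_seq a" "sine_cond a"
  shows "PS_on (\<lambda>k x. a k * sin (real k * x)) {0..pi}"
  unfolding PS_on_def
proof (intro allI impI ballI)
  fix n :: nat and x :: real
  assume n: "1 \<le> n" and x: "x \<in> {0..pi}"
  have "0 \<le> (\<Sum>k=1..n. a k / gamma_seq k * (gamma_seq k * sin (real k * x)))"
  proof (rule antimono_weighted_sum_nonneg)
    show "antimono_on {1..} (\<lambda>k. a k / gamma_seq k)"
      using gamma_seq_succeq[OF assms(2)] by (simp add: seq_succeq_def)
    show "0 \<le> a k / gamma_seq k" if "1 \<le> k" for k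
      using assms(1) gamma_seq_pos[OF that] that by (simp add: pos_seq_def less_imp_le)
    show "0 \<le> gamma_sum n x" if "1 \<le> n" for n
      using that x by (intro gamma_sum_nonneg) auto
  qed (rule n)
  also have "\<dots> = (\<Sum>k=1..n. a k * sin (real k * x))"
  proof (rule sum.cong)
    fix k assume "k \<in> {1..n}"
    thus "a k / gamma_seq k * (gamma_seq k * sin (real k * x)) = a k * sin (real k * x)"
      using gamma_seq_pos[of k] by simp
  qed simp
  finally show "0 \<le> (\<Sum>k=1..n. a k * sin (real k * x))" .
qed

theorem lemma2:
  "(\<forall>a :: nat \<Rightarrow> real. pos_seq a \<and> sine_cond a \<longrightarrow>
      PS_on (\<lambda>k x. a k * sin (real k * x)) {0..pi}) \<and>
   maximal_seq sine_cond gamma_seq"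
  using sine_cond_PS gamma_seq_succeq sine_cond_gamma_seq gamma_seq_pos
  unfolding maximal_seq_def pos_seq_def by blast

end
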